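(* Let $(\mathcal{M},E)$ be a regular matroid of rank $r$ with $|E|=m$, represented over $\mathbb{R}$ by an $r\times m$ weakly unimodular matrix $M$ of rank $r$, and let $\Lambda(\mathcal{M})=\ker(M)\cap\mathbb{Z}^E$. For any nonzero $\alpha\in\Lambda(\mathcal{M})$, the following are equivalent: (a) $\alpha$ is a simple flow of $\Lambda(\mathcal{M})$ (relative to $M$); (b) for all nonzero $\beta,\gamma\in\Lambda(\mathcal{M})$ such that $\alpha=\beta+\gamma$, one has $\langle\beta,\gamma\rangle<0$.
   Context: All matroids are on finite ground sets. An integer matrix is totally unimodular (TU) if every square submatrix has determinant in $\{-1,0,+1\}$, and weakly unimodular (WU) if every maximal square submatrix has determinant in $\{-1,0,+1\}$. A matroid of rank $r$ on a set $E$ of size $m$ is regular if it is the column-matroid over $\mathbb{R}$ of some $r\times m$ TU matrix of rank $r$ with columns labelled by $E$. A matrix $M$ with columns labelled by $E$ represents $\mathcal{M}$ if $\mathcal{M}$ is its column-matroid over $\mathbb{R}$. Here $\ker(M)\subseteq\mathbb{R}^E$ and $\langle\cdot,\cdot\rangle$ is the Euclidean dot product on $\mathbb{R}^E$. For $\beta\in\mathbb{Z}^E$, $\mathrm{supp}(\beta)=\{e\in E:\beta(e)\neq 0\}$. An element of $\Lambda(\mathcal{M})$ is a simple flow if it is nonzero, all its coordinates lie in $\{-1,0,+1\}$, and its support is a circuit (minimal dependent set) of $\mathcal{M}$. *)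

theory Defs
  imports "Jordan_Normal_Form.DL_Submatrix" "Jordan_Normal_Form.DL_Rank"
    "Jordan_Normal_Form.Matrix_Kernel"
begin

locale matroid =
  fixes E :: "'e set" and indep :: "'e set \<Rightarrow> bool"
  assumes finite_ground: "finite E"
    and indep_subset_ground: "indep X \<Longrightarrow> X \<subseteq> E"
    and indep_empty: "indep {}"
    and indep_subset: "indep X \<Longrightarrow> Y \<subseteq> X \<Longrightarrow> indep Y"
    and augment: "indep X \<Longrightarrow> indep Y \<Longrightarrow> card Y < card X \<Longrightarrow> \<exists>e\<in>X - Y. indep (insert e Y)"

definition matroid_rank :: "'e set \<Rightarrow> ('e set \<Rightarrow> bool) \<Rightarrow> nat" where
  "matroid_rank E indep = Max {card X |X. X \<subseteq> E \<and> indep X}"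

definition circuit :: "'e set \<Rightarrow> ('e set \<Rightarrow> bool) \<Rightarrow> 'e set \<Rightarrow> bool" where
  "circuit E indep C \<longleftrightarrow> C \<subseteq> E \<and> \<not> indep C \<and> (\<forall>D. D \<subset> C \<longrightarrow> indep D)"

definition totally_unimodular :: "int mat \<Rightarrow> bool" where
  "totally_unimodular A \<longleftrightarrow>
     (\<forall>I J. I \<subseteq> {..<dim_row A} \<and> J \<subseteq> {..<dim_col A} \<and> card I = card J
        \<longrightarrow> det (submatrix A I J) \<in> {-1, 0, 1})"

definition weakly_unimodular :: "int mat \<Rightarrow> bool" where
  "weakly_unimodular A \<longleftrightarrow>
     (\<forall>I J. I \<subseteq> {..<dim_row A} \<and> J \<subseteq> {..<dim_col A}
        \<and> card I = min (dim_row A) (dim_col A) \<and> card J = min (dim_row A) (dim_col A)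
        \<longrightarrow> det (submatrix A I J) \<in> {-1, 0, 1})"

abbreviation real_mat :: "int mat \<Rightarrow> real mat" where
  "real_mat A \<equiv> map_mat real_of_int A"

definition real_rank :: "int mat \<Rightarrow> nat" where
  "real_rank A = vec_space.rank (dim_row A) (real_mat A)"

(* Columns form a family: two equal columns are dependent, hence the injectivity clause,
   as lin_dep is a predicate on sets of vectors. *)
definition columns_indep :: "int mat \<Rightarrow> nat set \<Rightarrow> bool" where
  "columns_indep A J \<longleftrightarrow>
     inj_on (col (real_mat A)) J \<and>
     \<not> LinearCombinations.module.lin_dep class_ring (module_vec TYPE(real) (dim_row A))
         (col (real_mat A) ` J)"

(* The j-th column of A carries the label lab j. *)
definition represents ::
  "int mat \<Rightarrow> (nat \<Rightarrow> 'e) \<Rightarrow> 'e set \<Rightarrow> ('e set \<Rightarrow> bool) \<Rightarrow> bool" where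
  "represents A lab E indep \<longleftrightarrow>
     bij_betw lab {..<dim_col A} E \<and>
     (\<forall>J \<subseteq> {..<dim_col A}. indep (lab ` J) \<longleftrightarrow> columns_indep A J)"

definition regular_matroid :: "'e set \<Rightarrow> ('e set \<Rightarrow> bool) \<Rightarrow> bool" where
  "regular_matroid E indep \<longleftrightarrow>
     matroid E indep \<and>
     (\<exists>A lab. A \<in> carrier_mat (matroid_rank E indep) (card E) \<and> totally_unimodular A \<and>
        real_rank A = matroid_rank E indep \<and> represents A lab E indep)"

(* Vectors of R^E are written in the coordinates given by the column order of A:
   the coordinate at the label lab j is v $ j. *)
definition flow_lattice :: "int mat \<Rightarrow> real vec set" where
  "flow_lattice A = mat_kernel (real_mat A) \<inter> {v \<in> carrier_vec (dim_col A). \<forall>j<dim_col A. v $ j \<in> \<int>}"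

definition vec_supp :: "(nat \<Rightarrow> 'e) \<Rightarrow> real vec \<Rightarrow> 'e set" where
  "vec_supp lab v = {lab j |j. j < dim_vec v \<and> v $ j \<noteq> 0}"

definition simple_flow ::
  "int mat \<Rightarrow> (nat \<Rightarrow> 'e) \<Rightarrow> 'e set \<Rightarrow> ('e set \<Rightarrow> bool) \<Rightarrow> real vec \<Rightarrow> bool" where
  "simple_flow A lab E indep v \<longleftrightarrow>
     v \<in> flow_lattice A \<and> v \<noteq> 0\<^sub>v (dim_col A) \<and>
     (\<forall>j<dim_col A. v $ j \<in> {-1, 0, 1}) \<and>
     circuit E indep (vec_supp lab v)"

end

theory Submission
  imports Defs
begin

text \<open>
  The proof rests on elementary vectors: nonzero vectors of the kernel whose support is minimal.
  Since a set of columns is dependent exactly if it contains the support of a nonzero kernel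
  vector, the supports of elementary vectors are the circuits, and a simple flow is an elementary
  vector with entries in {-1, 0, 1} (\<open>circuit_vec_supp_iff_elementary\<close>).

  From simple flows to negative products: let \<open>\<alpha> = \<beta> + \<gamma>\<close> with integral \<open>\<beta>\<close> and \<open>\<gamma>\<close> and all entries
  of \<open>\<alpha>\<close> in {-1, 0, 1}. Two integers whose sum has absolute value at most 1 never have the same
  strict sign, so each coordinate contributes a nonpositive amount to the product of \<open>\<beta>\<close> and
  \<open>\<gamma>\<close>. If the product were zero, the supports of \<open>\<beta>\<close> and \<open>\<gamma>\<close> would be disjoint subsets of the
  support of \<open>\<alpha>\<close>; by minimality both would equal it, so \<open>\<alpha>\<close> would be zero.

  Conversely, every nonzero kernel vector \<open>\<alpha>\<close> admits a simple flow \<open>\<sigma>\<close> that conforms to it: \<open>\<sigma>\<close>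
  is supported within \<open>\<alpha>\<close> and agrees with it in sign. If \<open>\<alpha>\<close> is integral and different from
  \<open>\<sigma>\<close>, then \<open>\<alpha> = \<sigma> + (\<alpha> - \<sigma>)\<close> is a decomposition whose two parts have nonnegative product,
  because subtracting a unit from a nonzero integer towards zero does not reverse its sign.

  The conforming flow is found in two steps. Subtracting multiples of other kernel vectors shrinks
  the support of \<open>\<alpha>\<close>, without reversing a sign, down to an elementary vector
  (\<open>exists_conformal_elementary\<close>). Weak unimodularity then makes all its nonzero entries equal in
  absolute value (\<open>elementary_abs_le\<close>): completing the circuit without one of its elements to a
  basis, Cramer's rule expresses the quotient of two entries as a quotient of maximal minors, with
  a nonsingular one in the denominator.
\<close>

section \<open>Supports of kernel vectors and circuits\<close>

definition supp :: "real vec \<Rightarrow> nat set" where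
  "supp x = {j. j < dim_vec x \<and> x $ j \<noteq> 0}"

text \<open>
  Elementary vectors in the sense of Rockafellar. Equality of supports, instead of the absence of
  a strictly smaller one, is the form in which minimality gets applied.
\<close>
definition elementary :: "real mat \<Rightarrow> real vec \<Rightarrow> bool" where
  "elementary A x \<longleftrightarrow> x \<in> mat_kernel A \<and> x \<noteq> 0\<^sub>v (dim_col A) \<and>
     (\<forall>y \<in> mat_kernel A. y \<noteq> 0\<^sub>v (dim_col A) \<longrightarrow> supp y \<subseteq> supp x \<longrightarrow> supp y = supp x)"

lemma mat_kernel_iff_sum:
  fixes A :: "real mat"
  shows "x \<in> mat_kernel A \<longleftrightarrow> dim_vec x = dim_col A \<and>
    (\<forall>i<dim_row A. (\<Sum>j<dim_col A. A $$ (i, j) * x $ j) = 0)"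
proof -
  have "(A *\<^sub>v x) $ i = (\<Sum>j<dim_col A. A $$ (i, j) * x $ j)"
    if "i < dim_row A" "dim_vec x = dim_col A" for i
    using that by (simp add: scalar_prod_def atLeast0LessThan)
  then have "A *\<^sub>v x = 0\<^sub>v (dim_row A) \<longleftrightarrow> (\<forall>i<dim_row A. (\<Sum>j<dim_col A. A $$ (i, j) * x $ j) = 0)"
    if "dim_vec x = dim_col A"
    using that unfolding vec_eq_iff by (simp del: index_mult_mat_vec)
  then show ?thesis unfolding mat_kernel_def carrier_vec_def by blast
qed

lemma nonzero_iff_supp: "dim_vec x = n \<Longrightarrow> x \<noteq> 0\<^sub>v n \<longleftrightarrow> supp x \<noteq> {}"
  by (auto simp: supp_def vec_eq_iff)

text \<open>
  Kernel vectors supported in \<open>J\<close> are the linear relations among the columns with index in \<open>J\<close>.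
  Linear dependence speaks about the set of these columns, so a relation has to be
  moved along the column map, which is injective as soon as there is no nontrivial relation:
  two equal columns are related by the coefficients 1 and -1.
\<close>
lemma columns_indep_iff_kernel:
  assumes J: "J \<subseteq> {..<dim_col A}"
  shows "columns_indep A J \<longleftrightarrow>
    (\<forall>x \<in> mat_kernel (real_mat A). supp x \<subseteq> J \<longrightarrow> x = 0\<^sub>v (dim_col A))"
proof -
  define n where "n = dim_row A"
  define R where "R = real_mat A"
  define c where "c = col R"
  have dimR: "dim_row R = n" "dim_col R = dim_col A" by (simp_all add: R_def n_def)
  interpret V: vec_space "TYPE(real)" n .
  have fin: "finite J" using J finite_subset by blast
  have c_carrier: "c ` J \<subseteq> carrier_vec n" by (auto simp: c_def dimR intro!: carrier_vecI)
  have c_nth: "c j $ i = R $$ (i, j)" if "j \<in> J" "i < n" for i j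
    using that J by (auto simp: c_def dimR)
  have lincomb_nth: "V.lincomb a (c ` J) $ i = (\<Sum>j\<in>J. a (c j) * R $$ (i, j))"
    if "inj_on c J" "i < n" for a i
    using that c_nth by (simp add: V.lincomb_index[OF _ c_carrier] sum.reindex)
  have row_sum: "(\<Sum>j<dim_col A. R $$ (i, j) * x $ j) = (\<Sum>j\<in>J. x $ j * R $$ (i, j))"
    if "supp x \<subseteq> J" "dim_vec x = dim_col A" for x :: "real vec" and i
  proof -
    have "(\<Sum>j\<in>J. x $ j * R $$ (i, j)) = (\<Sum>j<dim_col A. x $ j * R $$ (i, j))"
      using that J by (intro sum.mono_neutral_left) (auto simp: supp_def)
    then show ?thesis by (simp add: mult.commute)
  qed
  have unfold: "columns_indep A J \<longleftrightarrow> inj_on c J \<and> \<not> V.lin_dep (c ` J)"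
    unfolding columns_indep_def c_def n_def R_def ..
  show ?thesis
    unfolding R_def[symmetric]
  proof
    assume "columns_indep A J"
    then have inj: "inj_on c J" and indpt: "\<not> V.lin_dep (c ` J)" using unfold by auto
    show "\<forall>x \<in> mat_kernel (R). supp x \<subseteq> J \<longrightarrow> x = 0\<^sub>v (dim_col A)"
    proof (intro ballI impI, rule ccontr)
      fix x assume x: "x \<in> mat_kernel (R)" "supp x \<subseteq> J" "x \<noteq> 0\<^sub>v (dim_col A)"
      have dim: "dim_vec x = dim_col A" using x(1) by (simp add: mat_kernel_iff_sum dimR)
      obtain j where j: "j \<in> J" "x $ j \<noteq> 0"
        using x(2,3) nonzero_iff_supp[OF dim] by (auto simp: supp_def)
      define a where "a v = x $ the_inv_into J c v" for v
      have a: "a (c k) = x $ k" if "k \<in> J" for k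
        using that inj by (simp add: a_def the_inv_into_f_f)
      have "V.lincomb a (c ` J) = 0\<^sub>v n"
      proof (rule eq_vecI)
        show "dim_vec (V.lincomb a (c ` J)) = dim_vec (0\<^sub>v n)"
          using V.lincomb_dim[OF _ c_carrier] fin by simp
        fix i assume "i < dim_vec (0\<^sub>v n)"
        then have i: "i < n" by simp
        have "V.lincomb a (c ` J) $ i = (\<Sum>j\<in>J. x $ j * R $$ (i, j))"
          unfolding lincomb_nth[OF inj i] by (intro sum.cong) (auto simp: a)
        also have "\<dots> = 0"
          using x(1) i row_sum[OF x(2) dim, of i] by (simp add: mat_kernel_iff_sum dimR)
        finally show "V.lincomb a (c ` J) $ i = 0\<^sub>v n $ i" using i by simp
      qed
      then have "V.lin_dep (c ` J)"
        using fin j a by (intro V.lin_dep_crit[where A = "c ` J" and S = "c ` J" and a = a and v = "c j"]) auto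
      then show False using indpt by simp
    qed
  next
    assume triv: "\<forall>x \<in> mat_kernel (R). supp x \<subseteq> J \<longrightarrow> x = 0\<^sub>v (dim_col A)"
    \<comment> \<open>repeated columns and linear dependence both contradict this form of \<open>triv\<close>, for relations
      that are given by coefficients on \<open>J\<close> only\<close>
    have vanish: "y j = 0" if j: "j \<in> J"
      and y: "\<And>i. i < n \<Longrightarrow> (\<Sum>j\<in>J. y j * R $$ (i, j)) = 0" for y j
    proof -
      define x where "x = vec (dim_col A) (\<lambda>j. if j \<in> J then y j else 0)"
      have sx: "supp x \<subseteq> J" by (auto simp: supp_def x_def split: if_splits)
      have dim: "dim_vec x = dim_col A" by (simp add: x_def)
      have "(\<Sum>j\<in>J. x $ j * R $$ (i, j)) = (\<Sum>j\<in>J. y j * R $$ (i, j))" for i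
        using J by (intro sum.cong) (auto simp: x_def)
      then have "x \<in> mat_kernel (R)"
        using row_sum[OF sx dim] y by (simp add: mat_kernel_iff_sum dim dimR)
      then have "x = 0\<^sub>v (dim_col A)" using triv sx by blast
      then have "x $ j = 0" using j J by auto
      then show ?thesis using j J by (auto simp: x_def)
    qed
    have inj: "inj_on c J"
    proof (rule inj_onI, rule ccontr)
      fix j k assume jk: "j \<in> J" "k \<in> J" "c j = c k" "j \<noteq> k"
      define y where "y l = (if l = j then 1 else if l = k then -1 else 0 :: real)" for l
      have "(\<Sum>l\<in>J. y l * R $$ (i, l)) = 0" if i: "i < n" for i
      proof -
        have "(\<Sum>l\<in>J. y l * R $$ (i, l)) = (\<Sum>l\<in>{j,k}. y l * R $$ (i, l))"
          using jk fin by (intro sum.mono_neutral_right) (auto simp: y_def)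
        also have "\<dots> = c j $ i - c k $ i"
          using jk(4) c_nth[OF jk(1) i] c_nth[OF jk(2) i] by (simp add: y_def)
        finally show ?thesis using jk(3) by simp
      qed
      then have "y j = 0" by (rule vanish[OF jk(1)])
      then show False by (simp add: y_def)
    qed
    have "\<not> V.lin_dep (c ` J)"
    proof
      assume "V.lin_dep (c ` J)"
      then obtain a v where a: "V.lincomb a (c ` J) = 0\<^sub>v n" "v \<in> c ` J" "a v \<noteq> 0"
        using V.finite_lin_dep[of "c ` J"] fin c_carrier by auto
      then obtain j where j: "j \<in> J" "v = c j" by auto
      have "(\<Sum>j\<in>J. a (c j) * R $$ (i, j)) = 0" if i: "i < n" for i
        using lincomb_nth[OF inj i, of a] a(1) i by simp
      then have "a (c j) = 0" by (rule vanish[OF j(1)])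
      then show False using a j by simp
    qed
    then show "columns_indep A J" using inj unfold by simp
  qed
qed

text \<open>
  A proper subset of the support of \<open>x\<close> is dependent exactly if it contains the support of a
  nonzero kernel vector, so minimality as a dependent set is minimality as a support.
\<close>
lemma circuit_vec_supp_iff_elementary:
  assumes rep: "represents A lab E indep"
    and x: "x \<in> mat_kernel (real_mat A)" "x \<noteq> 0\<^sub>v (dim_col A)"
  shows "circuit E indep (vec_supp lab x) \<longleftrightarrow> elementary (real_mat A) x"
proof -
  have bij: "bij_betw lab {..<dim_col A} E"
    and indep: "\<And>J. J \<subseteq> {..<dim_col A} \<Longrightarrow> indep (lab ` J) \<longleftrightarrow> columns_indep A J"
    using rep by (auto simp: represents_def)
  have inj: "inj_on lab {..<dim_col A}" using bij by (simp add: bij_betw_def)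
  have supp_le: "supp y \<subseteq> {..<dim_col A}" if "y \<in> mat_kernel (real_mat A)" for y
    using that by (auto simp: supp_def mat_kernel_iff_sum)
  have vs: "vec_supp lab x = lab ` supp x" by (auto simp: vec_supp_def supp_def)
  note sx = supp_le[OF x(1)]
  show ?thesis
  proof
    assume C: "circuit E indep (vec_supp lab x)"
    have "supp y = supp x" if y: "y \<in> mat_kernel (real_mat A)" "y \<noteq> 0\<^sub>v (dim_col A)"
      and sub: "supp y \<subseteq> supp x" for y
    proof (rule ccontr)
      assume "supp y \<noteq> supp x"
      then have "lab ` supp y \<subset> lab ` supp x"
        using sub inj_on_image_eq_iff[OF inj, of "supp y" "supp x"] sx by blast
      then have "columns_indep A (supp y)"
        using C indep[OF supp_le[OF y(1)]] vs by (auto simp: circuit_def)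
      then show False using columns_indep_iff_kernel[OF supp_le[OF y(1)]] y by auto
    qed
    then show "elementary (real_mat A) x" using x by (auto simp: elementary_def)
  next
    assume el: "elementary (real_mat A) x"
    have "\<not> indep (lab ` supp x)"
      using indep[OF sx] columns_indep_iff_kernel[OF sx] x by auto
    moreover have "indep D" if D: "D \<subset> lab ` supp x" for D
    proof -
      obtain J where J: "J \<subseteq> supp x" "D = lab ` J" using D by (meson psubset_imp_subset subset_imageE)
      have "J \<noteq> supp x" using D J(2) by auto
      have JA: "J \<subseteq> {..<dim_col A}" using J sx by auto
      have "columns_indep A J"
        unfolding columns_indep_iff_kernel[OF JA]
        using el J(1) \<open>J \<noteq> supp x\<close> by (auto simp: elementary_def)
      then show ?thesis using indep[OF JA] J by simp
    qed
    moreover have "lab ` supp x \<subseteq> E" using sx bij by (auto simp: bij_betw_def)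
    ultimately show "circuit E indep (vec_supp lab x)" unfolding vs circuit_def by auto
  qed
qed

section \<open>Conformal elementary vectors\<close>

lemma mat_kernel_minus_smult:
  fixes A :: "real mat"
  assumes "x \<in> mat_kernel A" "y \<in> mat_kernel A"
  shows "x - t \<cdot>\<^sub>v y \<in> mat_kernel A"
proof -
  have dims: "dim_vec x = dim_col A" "dim_vec y = dim_col A"
    using assms by (auto simp: mat_kernel_iff_sum)
  have "(\<Sum>j<dim_col A. A $$ (i, j) * (x - t \<cdot>\<^sub>v y) $ j) = 0" if i: "i < dim_row A" for i
  proof -
    have "(\<Sum>j<dim_col A. A $$ (i, j) * (x - t \<cdot>\<^sub>v y) $ j)
      = (\<Sum>j<dim_col A. A $$ (i, j) * x $ j - t * (A $$ (i, j) * y $ j))"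
      by (rule sum.cong) (simp_all add: dims right_diff_distrib)
    also have "\<dots> = (\<Sum>j<dim_col A. A $$ (i, j) * x $ j) - t * (\<Sum>j<dim_col A. A $$ (i, j) * y $ j)"
      by (simp only: sum_subtractf sum_distrib_left)
    also have "\<dots> = 0" using assms i unfolding mat_kernel_iff_sum by simp
    finally show ?thesis .
  qed
  then show ?thesis unfolding mat_kernel_iff_sum using dims by simp
qed

text \<open>
  If the support of \<open>x\<close> is not minimal, it strictly contains the support of a kernel vector. Moving
  from \<open>x\<close> along this vector until the first entry vanishes reverses no sign and loses a coordinate;
  the result is nonzero, because it agrees with \<open>x\<close> outside the smaller support.
\<close>
lemma exists_conformal_elementary:
  fixes A :: "real mat"
  assumes x: "x \<in> mat_kernel A" "x \<noteq> 0\<^sub>v (dim_col A)"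
  shows "\<exists>y. elementary A y \<and> supp y \<subseteq> supp x \<and> (\<forall>j<dim_col A. 0 \<le> x $ j * y $ j)"
  using x
proof (induction "card (supp x)" arbitrary: x rule: less_induct)
  case less
  note x = less.prems
  have dx: "dim_vec x = dim_col A" using x by (simp add: mat_kernel_iff_sum)
  have fin: "finite (supp x)" by (simp add: supp_def)
  show ?case
  proof (cases "elementary A x")
    case True then show ?thesis by auto
  next
    case False
    then obtain z where z: "z \<in> mat_kernel A" "z \<noteq> 0\<^sub>v (dim_col A)" "supp z \<subset> supp x"
      using x by (auto simp: elementary_def)
    have dz: "dim_vec z = dim_col A" using z by (simp add: mat_kernel_iff_sum)
    obtain k where k: "k < dim_col A" "z $ k \<noteq> 0"
      using z(2) nonzero_iff_supp[OF dz] by (auto simp: supp_def dz)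
    have xk: "x $ k \<noteq> 0" using z(3) k dz by (auto simp: supp_def)
    \<comment> \<open>the multiple \<open>(z $ k * x $ k) \<cdot>\<^sub>v z\<close> agrees with \<open>x\<close> in sign at \<open>k\<close>, so that some coordinate
      shrinks when \<open>w\<close> is subtracted\<close>
    define w where "w = 0\<^sub>v (dim_col A) - (- (z $ k * x $ k)) \<cdot>\<^sub>v z"
    have dw: "dim_vec w = dim_col A" by (simp add: w_def dz)
    have wj: "w $ j = z $ k * x $ k * z $ j" if "j < dim_col A" for j
      using that by (simp add: w_def dz)
    have "0\<^sub>v (dim_col A) \<in> mat_kernel A" by (simp add: mat_kernel_iff_sum)
    then have w: "w \<in> mat_kernel A" unfolding w_def using z(1) by (rule mat_kernel_minus_smult)
    have sw: "supp w = supp z" using k xk by (auto simp: supp_def dw dz wj)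
    define P where "P = {j. j < dim_col A \<and> 0 < x $ j * w $ j}"
    have "0 < (x $ k * z $ k)\<^sup>2" using k xk by simp
    also have "\<dots> = x $ k * w $ k" using k by (simp add: wj power2_eq_square)
    finally have "k \<in> P" using k by (simp add: P_def)
    have finP: "finite P" by (simp add: P_def)
    \<comment> \<open>only coordinates in \<open>P\<close> move towards zero; \<open>t\<close> is the moment at which the first of them
      arrives there\<close>
    define t where "t = Min ((\<lambda>j. x $ j / w $ j) ` P)"
    have "t \<in> (\<lambda>j. x $ j / w $ j) ` P"
      unfolding t_def using finP \<open>k \<in> P\<close> by (intro Min_in) auto
    then obtain l where l: "l \<in> P" "t = x $ l / w $ l" by auto
    have t_le: "t \<le> x $ j / w $ j" if "j \<in> P" for j
      unfolding t_def using that finP by (intro Min_le) auto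
    have t_pos: "0 < t" using l by (auto simp: P_def zero_less_mult_iff zero_less_divide_iff)
    define y where "y = x - t \<cdot>\<^sub>v w"
    have dy: "dim_vec y = dim_col A" by (simp add: y_def dw)
    have yj: "y $ j = x $ j - t * w $ j" if "j < dim_col A" for j
      using that by (simp add: y_def dw)
    have y: "y \<in> mat_kernel A" unfolding y_def using x(1) w by (rule mat_kernel_minus_smult)
    have conf: "0 \<le> x $ j * y $ j" if j: "j < dim_col A" for j
    proof (cases "j \<in> P")
      case True
      then have "t * (x $ j * w $ j) \<le> x $ j / w $ j * (x $ j * w $ j)"
        using t_le[OF True] by (intro mult_right_mono) (auto simp: P_def)
      also have "\<dots> = x $ j * x $ j" using True by (auto simp: P_def)
      finally show ?thesis by (simp add: yj[OF j] algebra_simps)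
    next
      case False
      then have "t * (x $ j * w $ j) \<le> 0"
        using j t_pos by (auto simp: P_def mult_le_0_iff not_less)
      also have "0 \<le> x $ j * x $ j" by simp
      finally show ?thesis by (simp add: yj[OF j] algebra_simps)
    qed
    have "y $ l = 0" "x $ l \<noteq> 0" "l < dim_col A" using l by (auto simp: P_def yj)
    moreover have "supp y \<subseteq> supp x"
    proof
      fix j assume "j \<in> supp y"
      then have j: "j < dim_col A" "x $ j - t * w $ j \<noteq> 0" by (auto simp: supp_def dy yj)
      have "w $ j = 0" if "x $ j = 0"
      proof -
        have "j \<notin> supp w" using that z(3) sw by (auto simp: supp_def dx)
        then show ?thesis using j by (simp add: supp_def dw)
      qed
      then show "j \<in> supp x" using j by (auto simp: supp_def dx)
    qed
    ultimately have sub: "supp y \<subset> supp x" by (auto simp: supp_def dx dy)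
    obtain q where "q \<in> supp x" "q \<notin> supp w" using z(3) sw by auto
    then have "q \<in> supp y" by (auto simp: supp_def dx dy dw yj)
    then have "y \<noteq> 0\<^sub>v (dim_col A)" using nonzero_iff_supp[OF dy] by auto
    then obtain v where v: "elementary A v" "supp v \<subseteq> supp y" "\<forall>j<dim_col A. 0 \<le> y $ j * v $ j"
      using less.hyps[OF psubset_card_mono[OF fin sub] y] by blast
    have dv: "dim_vec v = dim_col A" using v(1) by (simp add: elementary_def mat_kernel_iff_sum)
    have "0 \<le> x $ j * v $ j" if j: "j < dim_col A" for j
    proof (cases "v $ j = 0")
      case False
      then have "y $ j \<noteq> 0" using v(2) j dv by (auto simp: supp_def)
      moreover have "0 \<le> x $ j * y $ j" "0 \<le> y $ j * v $ j" using conf v(3) j by auto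
      ultimately show ?thesis by (auto simp: zero_le_mult_iff)
    qed simp
    then show ?thesis using v sub by blast
  qed
qed

section \<open>Maximal minors\<close>

text \<open>
  Weak unimodularity speaks about submatrices with columns in increasing order. Cramer's rule
  replaces a column in place, which destroys that order; restoring it by a permutation
  only affects the sign of the determinant.
\<close>
lemma det_col_selection_weakly_unimodular:
  assumes M: "M \<in> carrier_mat r m" and wu: "weakly_unimodular M"
    and inj: "inj_on g {..<r}" and g: "g ` {..<r} \<subseteq> {..<m}"
  shows "det (mat r r (\<lambda>(i, k). M $$ (i, g k))) \<in> {-1, 0, 1}"
proof -
  define J where "J = g ` {..<r}"
  have cardJ: "card J = r" using inj by (simp add: J_def card_image)
  have finJ: "finite J" by (simp add: J_def)
  have rm: "r \<le> m" using cardJ g card_mono[of "{..<m}" J] by (simp add: J_def)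
  define S where "S = submatrix M {..<r} J"
  have idx: "{i. i < r \<and> i \<in> {..<r}} = {..<r}" "{j. j < m \<and> j \<in> J} = J"
    using g by (auto simp: J_def)
  have S: "S \<in> carrier_mat r r"
    using M idx cardJ by (auto simp: S_def submatrix_def)
  have detS: "det S \<in> {-1, 0, 1}"
    using wu M g rm cardJ unfolding weakly_unimodular_def S_def J_def by (simp add: min_def)
  \<comment> \<open>\<open>p k\<close> is the rank of \<open>g k\<close> among the selected columns; outside the index range it has to be
    the identity for \<open>p\<close> to be a permutation\<close>
  define p where "p k = (if k < r then card {a \<in> J. a < g k} else k)" for k
  have pick: "pick J (p k) = g k" if "k < r" for k
    using that pick_card_in_set[of "g k" J] by (simp add: p_def J_def)
  have p_less: "p k < r" if "k < r" for k
  proof -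
    have "{a \<in> J. a < g k} \<subset> J" using that by (auto simp: J_def)
    then show ?thesis using that psubset_card_mono[OF finJ] cardJ by (auto simp: p_def)
  qed
  have "inj_on p {0..<r}"
    using inj pick by (intro inj_onI) (metis atLeastLessThan_iff inj_onD lessThan_iff)
  then have "bij_betw p {0..<r} {0..<r}"
    using p_less endo_inj_surj[of "{0..<r}" p] by (simp add: bij_betw_def image_subset_iff)
  then have perm: "p permutes {0..<r}"
    by (rule bij_imp_permutes) (simp add: p_def)
  define N where "N = mat r r (\<lambda>(i, k). M $$ (i, g k))"
  have N: "N \<in> carrier_mat r r" by (simp add: N_def)
  have pick_r: "pick {..<r} i = i" if "i < r" for i
  proof -
    have "{a \<in> {..<r}. a < i} = {..<i}" using that by auto
    then show ?thesis using pick_card_in_set[of i "{..<r}"] that by simp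
  qed
  have "transpose_mat N = mat r r (\<lambda>(i, j). transpose_mat S $$ (p i, j))"
    using p_less pick pick_r S M idx cardJ
    by (intro eq_matI) (auto simp: N_def S_def submatrix_def)
  then have "det N = signof p * det S"
    using det_permute_rows[of "transpose_mat S" r p] S perm
      det_transpose[OF N] det_transpose[OF S] by simp
  then show ?thesis using detS unfolding N_def by (cases rule: sign_cases[of p]) auto
qed

lemma (in matroid) extend_to_basis:
  assumes "indep X"
  shows "\<exists>B. X \<subseteq> B \<and> indep B \<and> card B = matroid_rank E indep"
proof -
  let ?S = "{card X |X. X \<subseteq> E \<and> indep X}"
  have finS: "finite ?S"
    using finite_subset[of ?S "card ` Pow E"] finite_ground by auto
  have le: "card Y \<le> matroid_rank E indep" if "indep Y" for Y
    unfolding matroid_rank_def using finS that indep_subset_ground by (intro Max_ge) auto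
  have "matroid_rank E indep \<in> ?S"
    unfolding matroid_rank_def using finS indep_empty by (intro Max_in) auto
  then obtain Z where Z: "indep Z" "card Z = matroid_rank E indep" by auto
  show ?thesis
    using assms
  proof (induction "matroid_rank E indep - card X" arbitrary: X rule: less_induct)
    case less
    show ?case
    proof (cases "card X < card Z")
      case True
      then obtain e where e: "e \<in> Z - X" "indep (insert e X)" using augment Z less.prems by blast
      have "finite X" using less.prems indep_subset_ground finite_ground finite_subset by blast
      then have "card (insert e X) = Suc (card X)" using e by simp
      then obtain B where "insert e X \<subseteq> B" "indep B" "card B = matroid_rank E indep"
        using less.hyps[of "insert e X"] e(2) True Z(2) by (metis diff_less_mono2 lessI)
      then show ?thesis by blast
    next
      case False
      then show ?thesis using le[OF less.prems] less.prems Z(2) by auto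
    qed
  qed
qed

text \<open>
  The support of \<open>x\<close> without \<open>f\<close> is independent and hence contained in a basis \<open>B\<close>, which cannot
  contain \<open>f\<close>. Dividing the relation \<open>x\<close> by \<open>x $ f\<close> expresses column \<open>f\<close> through the columns in
  \<open>B\<close> with coefficients \<open>- x $ j / x $ f\<close>. By Cramer's rule each coefficient is the quotient
  of two maximal minors, so its absolute value is at most 1: the denominator is the minor on \<open>B\<close>,
  which is nonzero and thus \<open>\<plusminus>1\<close>.
  Equality of the absolute values follows by exchanging \<open>e\<close> and \<open>f\<close>.
\<close>
lemma elementary_abs_le:
  assumes mat: "matroid E indep" and rank: "matroid_rank E indep = r"
    and M: "M \<in> carrier_mat r m" and wu: "weakly_unimodular M"
    and rep: "represents M lab E indep"
    and el: "elementary (real_mat M) x" and e: "e \<in> supp x" and f: "f \<in> supp x"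
  shows "\<bar>x $ e\<bar> \<le> \<bar>x $ f\<bar>"
proof (cases "e = f")
  case False
  interpret matroid E indep by (fact mat)
  define R where "R = real_mat M"
  have dimM: "dim_row M = r" "dim_col M = m" using M by auto
  have dimR: "dim_row R = r" "dim_col R = m" using M by (auto simp: R_def)
  have bij: "bij_betw lab {..<m} E"
    and indep: "\<And>J. J \<subseteq> {..<m} \<Longrightarrow> indep (lab ` J) \<longleftrightarrow> columns_indep M J"
    using rep by (auto simp: represents_def dimM)
  have inj: "inj_on lab {..<m}" using bij by (simp add: bij_betw_def)
  have x: "x \<in> mat_kernel R" "x \<noteq> 0\<^sub>v m" using el by (auto simp: elementary_def dimM R_def)
  have dx: "dim_vec x = m" using x by (simp add: mat_kernel_iff_sum dimR)
  have sx: "supp x \<subseteq> {..<m}" by (auto simp: supp_def dx)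
  have fm: "f < m" and xf: "x $ f \<noteq> 0" using f by (auto simp: supp_def dx)
  have "circuit E indep (vec_supp lab x)"
    using circuit_vec_supp_iff_elementary[OF rep x(1)[unfolded R_def]] x(2) el by (simp add: dimM)
  moreover have "vec_supp lab x = lab ` supp x" by (auto simp: vec_supp_def supp_def)
  moreover have "lab ` (supp x - {f}) \<subset> lab ` supp x"
  proof -
    have "lab f \<notin> lab ` (supp x - {f})"
      using inj fm sx by (auto dest: inj_onD)
    then show ?thesis using f by blast
  qed
  ultimately have "indep (lab ` (supp x - {f}))" by (auto simp: circuit_def)
  then obtain B' where B': "lab ` (supp x - {f}) \<subseteq> B'" "indep B'" "card B' = r"
    using extend_to_basis rank by blast
  obtain B where B: "B \<subseteq> {..<m}" "B' = lab ` B"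
    using indep_subset_ground[OF B'(2)] bij by (metis bij_betw_imp_surj_on subset_imageE)
  have cardB: "card B = r" using B B'(3) inj card_image inj_on_subset by metis
  have finB: "finite B" using B finite_subset by blast
  have sB: "supp x - {f} \<subseteq> B"
    using B'(1) B(1) sx inj_on_image_mem_iff[OF inj _ B(1)] unfolding B(2) by blast
  have triv: "\<And>y. y \<in> mat_kernel R \<Longrightarrow> supp y \<subseteq> B \<Longrightarrow> y = 0\<^sub>v m"
    using columns_indep_iff_kernel[of B M] indep[OF B(1)] B B'(2) by (auto simp: dimM R_def)
  have fB: "f \<notin> B" using triv[OF x(1)] x(2) sB by auto
  obtain g where g: "bij_betw g {..<r} B"
    using ex_bij_betw_nat_finite[OF finB] cardB by (auto simp: atLeast0LessThan)
  have g_inj: "inj_on g {..<r}" and g_im: "g ` {..<r} = B" using g by (auto simp: bij_betw_def)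
  have g_less: "g k < m" if "k < r" for k using that g_im B(1) by auto
  define N where "N = mat r r (\<lambda>(i, k). R $$ (i, g k))"
  have N: "N \<in> carrier_mat r r" by (simp add: N_def)
  have N_int: "N = real_mat (mat r r (\<lambda>(i, k). M $$ (i, g k)))"
    using g_less by (intro eq_matI) (auto simp: N_def R_def dimM)
  have sum_B: "(\<Sum>k<r. N $$ (i, k) * y (g k)) = (\<Sum>j\<in>B. R $$ (i, j) * y j)"
    if i: "i < r" for i y
  proof -
    have "(\<Sum>j\<in>B. R $$ (i, j) * y j) = (\<Sum>k<r. R $$ (i, g k) * y (g k))"
      by (rule sum.reindex_bij_betw[OF g, symmetric])
    also have "\<dots> = (\<Sum>k<r. N $$ (i, k) * y (g k))"
      using i by (intro sum.cong) (auto simp: N_def)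
    finally show ?thesis by simp
  qed
  \<comment> \<open>a kernel vector of the basis matrix extends by zero to one supported in \<open>B\<close>, which vanishes\<close>
  have "det N \<noteq> 0"
  proof
    assume "det N = 0"
    then obtain v where v: "v \<in> carrier_vec r" "v \<noteq> 0\<^sub>v r" "N *\<^sub>v v = 0\<^sub>v r"
      using det_0_iff_vec_prod_zero_field[OF N] by blast
    have "v \<in> mat_kernel N" using v N by (intro mat_kernelI)
    then have vN: "(\<Sum>k<r. N $$ (i, k) * v $ k) = 0" if "i < r" for i
      using that N by (simp add: mat_kernel_iff_sum N_def)
    define h where "h = the_inv_into {..<r} g"
    have hg: "h (g k) = k" if "k < r" for k using that g_inj by (simp add: h_def the_inv_into_f_f)
    define y where "y = vec m (\<lambda>j. if j \<in> B then v $ h j else 0)"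
    have "(\<Sum>j<m. R $$ (i, j) * y $ j) = 0" if i: "i < r" for i
    proof -
      have "(\<Sum>j<m. R $$ (i, j) * y $ j) = (\<Sum>j\<in>B. R $$ (i, j) * v $ h j)"
        using B(1) by (intro sum.mono_neutral_cong_right) (auto simp: y_def)
      also have "\<dots> = (\<Sum>k<r. N $$ (i, k) * v $ k)"
        unfolding sum_B[OF i, symmetric] using hg by (intro sum.cong) auto
      finally show ?thesis using vN[OF i] by simp
    qed
    then have "y \<in> mat_kernel R" by (simp add: mat_kernel_iff_sum dimR y_def)
    moreover have "supp y \<subseteq> B" by (auto simp: supp_def y_def split: if_splits)
    ultimately have y0: "y = 0\<^sub>v m" by (rule triv)
    have "v $ k = 0" if k: "k < r" for k
    proof -
      have "y $ g k = v $ k" using k g_im g_less hg by (auto simp: y_def)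
      then show ?thesis using y0 g_less[OF k] by simp
    qed
    then show False using v by (auto simp: vec_eq_iff)
  qed
  moreover have "det (mat r r (\<lambda>(i, k). M $$ (i, g k))) \<in> {-1, 0, 1}"
    using det_col_selection_weakly_unimodular[OF M wu g_inj] g_im B(1) by simp
  ultimately have detN: "\<bar>det N\<bar> = 1" unfolding N_int by (auto simp: of_int_hom.hom_det)
  obtain k where k: "k < r" "g k = e" using e False sB g_im by (metis DiffI imageE lessThan_iff singletonD subsetD)
  define y where "y = vec r (\<lambda>k. - x $ g k / x $ f)"
  have Ny: "N *\<^sub>v y = col R f"
  proof (rule eq_vecI)
    show "dim_vec (N *\<^sub>v y) = dim_vec (col R f)" by (simp add: N_def dimR)
    fix i assume "i < dim_vec (col R f)"
    then have i: "i < r" by (simp add: dimR)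
    have "0 = (\<Sum>j<m. R $$ (i, j) * x $ j)"
      using x(1) i by (simp add: mat_kernel_iff_sum dimR)
    also have "\<dots> = (\<Sum>j\<in>insert f B. R $$ (i, j) * x $ j)"
      using B(1) fm sB by (intro sum.mono_neutral_right) (auto simp: supp_def dx)
    also have "\<dots> = R $$ (i, f) * x $ f + (\<Sum>j\<in>B. R $$ (i, j) * x $ j)"
      using fB finB by simp
    finally have "(\<Sum>j\<in>B. R $$ (i, j) * x $ j) = - R $$ (i, f) * x $ f" by simp
    then have s: "(\<Sum>k<r. N $$ (i, k) * x $ g k) = - R $$ (i, f) * x $ f"
      using sum_B[OF i, of "\<lambda>j. x $ j"] by simp
    have "(N *\<^sub>v y) $ i = (\<Sum>k<r. N $$ (i, k) * (- x $ g k / x $ f))"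
      using i by (simp add: scalar_prod_def N_def y_def atLeast0LessThan)
    also have "\<dots> = - (\<Sum>k<r. N $$ (i, k) * x $ g k) / x $ f"
      by (simp add: sum_divide_distrib sum_negf)
    also have "\<dots> = col R f $ i" using s xf i fm by (simp add: dimR)
    finally show "(N *\<^sub>v y) $ i = col R f $ i" .
  qed
  define L where "L = mat r r (\<lambda>(i, l). M $$ (i, (g(k := f)) l))"
  have "replace_col N (col R f) k = real_mat L"
    using fm g_less by (intro eq_matI) (auto simp: replace_col_def N_def L_def R_def dimM)
  moreover have "y \<in> carrier_vec r" by (simp add: y_def)
  ultimately have "det (real_mat L) = y $ k * det N"
    using cramer_lemma_mat[OF N, of y k] k(1) Ny by simp
  then have "\<bar>y $ k\<bar> = \<bar>det (real_mat L)\<bar>" using detN by (simp add: abs_mult)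
  moreover have "det L \<in> {-1, 0, 1}"
    unfolding L_def
  proof (rule det_col_selection_weakly_unimodular[OF M wu])
    show "inj_on (g(k := f)) {..<r}"
      using g_inj fB g_im by (intro inj_on_fun_updI) auto
    show "(g(k := f)) ` {..<r} \<subseteq> {..<m}" using g_less fm by auto
  qed
  ultimately have "\<bar>y $ k\<bar> \<le> 1" by (auto simp: of_int_hom.hom_det)
  then show ?thesis using k xf by (simp add: y_def abs_divide divide_le_eq_1)
qed simp

section \<open>Simple flows as indecomposable lattice vectors\<close>

text \<open>
  An elementary vector conforming to \<open>x\<close>, divided by the common absolute value of its nonzero
  entries, is a simple flow.
\<close>
lemma exists_conformal_unit_elementary:
  assumes mat: "matroid E indep" and rank: "matroid_rank E indep = r"
    and M: "M \<in> carrier_mat r m" and wu: "weakly_unimodular M"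
    and rep: "represents M lab E indep"
    and x: "x \<in> mat_kernel (real_mat M)" "x \<noteq> 0\<^sub>v m"
  shows "\<exists>\<sigma>. elementary (real_mat M) \<sigma> \<and> (\<forall>j<m. \<sigma> $ j \<noteq> 0 \<longrightarrow> x $ j \<noteq> 0 \<and> \<sigma> $ j = sgn (x $ j))"
proof -
  have dimM: "dim_row M = r" "dim_col M = m" using M by auto
  obtain y where y: "elementary (real_mat M) y" "supp y \<subseteq> supp x" "\<forall>j<m. 0 \<le> x $ j * y $ j"
    using exists_conformal_elementary[OF x(1)] x(2) by (auto simp: dimM)
  have yk: "y \<in> mat_kernel (real_mat M)" "y \<noteq> 0\<^sub>v m" using y(1) by (auto simp: elementary_def dimM)
  have dims: "dim_vec x = m" "dim_vec y = m" using x yk by (simp_all add: mat_kernel_iff_sum dimM)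
  obtain f where f: "f \<in> supp y" using nonzero_iff_supp[OF dims(2)] yk by auto
  define c where "c = \<bar>y $ f\<bar>"
  have c: "c > 0" using f by (simp add: c_def supp_def)
  have abs: "\<bar>y $ j\<bar> = c" if "j \<in> supp y" for j
    unfolding c_def using elementary_abs_le[OF mat rank M wu rep y(1)] that f by (meson antisym)
  \<comment> \<open>written as a difference to be covered by the closure property \<open>mat_kernel_minus_smult\<close>\<close>
  define \<sigma> where "\<sigma> = 0\<^sub>v m - (- 1 / c) \<cdot>\<^sub>v y"
  have dim\<sigma>: "dim_vec \<sigma> = m" by (simp add: \<sigma>_def dims)
  have \<sigma>j: "\<sigma> $ j = y $ j / c" if "j < m" for j using that by (simp add: \<sigma>_def dims)
  have s\<sigma>: "supp \<sigma> = supp y" using c by (auto simp: supp_def dim\<sigma> dims \<sigma>j)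
  have "\<sigma> \<in> mat_kernel (real_mat M)"
    unfolding \<sigma>_def using yk(1) by (intro mat_kernel_minus_smult) (simp_all add: mat_kernel_iff_sum dimM)
  then have "elementary (real_mat M) \<sigma>"
    using y(1) s\<sigma> nonzero_iff_supp[OF dim\<sigma>] f by (auto simp: elementary_def dimM)
  moreover have "x $ j \<noteq> 0 \<and> \<sigma> $ j = sgn (x $ j)" if j: "j < m" "\<sigma> $ j \<noteq> 0" for j
  proof -
    have "j \<in> supp y" using j s\<sigma> dim\<sigma> by (auto simp: supp_def)
    then have "x $ j \<noteq> 0" "y $ j \<noteq> 0" "\<bar>y $ j\<bar> = c" using y(2) abs by (auto simp: supp_def)
    then show ?thesis using \<sigma>j[OF j(1)] y(3) j(1) c
      by (auto simp: sgn_if abs_if zero_le_mult_iff split: if_splits)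
  qed
  ultimately show ?thesis by blast
qed

theorem proposition12:
  fixes E :: "'e set" and indep :: "'e set \<Rightarrow> bool"
    and M :: "int mat" and lab :: "nat \<Rightarrow> 'e"
    and r m :: nat and \<alpha> :: "real vec"
  assumes "regular_matroid E indep"
    and "matroid_rank E indep = r"
    and "card E = m"
    and "M \<in> carrier_mat r m"
    and "weakly_unimodular M"
    and "real_rank M = r"
    and "represents M lab E indep"
    and "\<alpha> \<in> flow_lattice M"
    and "\<alpha> \<noteq> 0\<^sub>v m"
  shows "simple_flow M lab E indep \<alpha> \<longleftrightarrow>
    (\<forall>\<beta> \<in> flow_lattice M. \<forall>\<gamma> \<in> flow_lattice M.
       \<beta> \<noteq> 0\<^sub>v m \<longrightarrow> \<gamma> \<noteq> 0\<^sub>v m \<longrightarrow> \<alpha> = \<beta> + \<gamma> \<longrightarrow> \<beta> \<bullet> \<gamma> < 0)"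
proof -
  have dimM: "dim_row M = r" "dim_col M = m" using assms(4) by simp_all
  have flow: "x \<in> flow_lattice M \<longleftrightarrow> x \<in> mat_kernel (real_mat M) \<and> (\<forall>j<m. x $ j \<in> \<int>)" for x
    unfolding flow_lattice_def mat_kernel_def by (auto simp: dimM)
  have dim: "dim_vec x = m" if "x \<in> flow_lattice M" for x
    using that by (simp add: flow mat_kernel_iff_sum dimM)
  have ker\<alpha>: "\<alpha> \<in> mat_kernel (real_mat M)" using assms(8) by (simp add: flow)
  have simple: "simple_flow M lab E indep \<alpha> \<longleftrightarrow>
      elementary (real_mat M) \<alpha> \<and> (\<forall>j<m. \<alpha> $ j \<in> {-1, 0, 1})"
    using circuit_vec_supp_iff_elementary[OF assms(7) ker\<alpha>] assms(8,9)
    by (auto simp: simple_flow_def dimM)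
  show ?thesis
    unfolding simple
  proof (intro iffI ballI impI)
    fix \<beta> \<gamma>
    assume \<alpha>: "elementary (real_mat M) \<alpha> \<and> (\<forall>j<m. \<alpha> $ j \<in> {-1, 0, 1})"
      and \<beta>: "\<beta> \<in> flow_lattice M" "\<beta> \<noteq> 0\<^sub>v m" and \<gamma>: "\<gamma> \<in> flow_lattice M" "\<gamma> \<noteq> 0\<^sub>v m"
      and sum: "\<alpha> = \<beta> + \<gamma>"
    note dims = dim[OF assms(8)] dim[OF \<beta>(1)] dim[OF \<gamma>(1)]
    have sumj: "\<alpha> $ j = \<beta> $ j + \<gamma> $ j" if "j < m" for j using that by (simp add: sum dims)
    have le: "\<beta> $ j * \<gamma> $ j \<le> 0" if j: "j < m" for j
    proof -
      have "\<beta> $ j \<in> \<int>" "\<gamma> $ j \<in> \<int>" using \<beta>(1) \<gamma>(1) j by (auto simp: flow)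
      then obtain b c :: int where bc: "\<beta> $ j = of_int b" "\<gamma> $ j = of_int c"
        by (elim Ints_cases)
      have "\<alpha> $ j \<in> {-1, 0, 1}" using \<alpha> j by blast
      then have "\<bar>b + c\<bar> \<le> 1" using sumj[OF j] bc by auto
      then have "(b \<le> 0 \<and> 0 \<le> c) \<or> (0 \<le> b \<and> c \<le> 0)" by linarith
      then show ?thesis by (auto simp: bc mult_le_0_iff)
    qed
    have dot: "\<beta> \<bullet> \<gamma> = (\<Sum>j<m. \<beta> $ j * \<gamma> $ j)" by (simp add: scalar_prod_def dims atLeast0LessThan)
    show "\<beta> \<bullet> \<gamma> < 0"
    proof (rule ccontr)
      assume "\<not> \<beta> \<bullet> \<gamma> < 0"
      moreover have "\<beta> \<bullet> \<gamma> \<le> 0" unfolding dot by (intro sum_nonpos) (auto simp: le)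
      ultimately have "(\<Sum>j<m. - (\<beta> $ j * \<gamma> $ j)) = 0" by (simp add: dot sum_negf)
      then have "\<forall>j\<in>{..<m}. - (\<beta> $ j * \<gamma> $ j) = 0"
        using le by (subst (asm) sum_nonneg_eq_0_iff) auto
      then have disj: "\<beta> $ j = 0 \<or> \<gamma> $ j = 0" if "j < m" for j using that by auto
      then have "supp \<beta> \<subseteq> supp \<alpha>" "supp \<gamma> \<subseteq> supp \<alpha>" "supp \<beta> \<inter> supp \<gamma> = {}"
        by (force simp: supp_def dims sumj)+
      moreover have "supp \<beta> = supp \<alpha>" "supp \<gamma> = supp \<alpha>"
        using \<alpha> \<beta> \<gamma> calculation by (auto simp: elementary_def dimM flow)
      ultimately have "supp \<alpha> = {}" by auto
      then show False using assms(9) nonzero_iff_supp[OF dims(1)] by auto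
    qed
  next
    assume neg: "\<forall>\<beta> \<in> flow_lattice M. \<forall>\<gamma> \<in> flow_lattice M.
       \<beta> \<noteq> 0\<^sub>v m \<longrightarrow> \<gamma> \<noteq> 0\<^sub>v m \<longrightarrow> \<alpha> = \<beta> + \<gamma> \<longrightarrow> \<beta> \<bullet> \<gamma> < 0"
    have "matroid E indep" using assms(1) by (simp add: regular_matroid_def)
    then obtain \<sigma> where \<sigma>: "elementary (real_mat M) \<sigma>"
      "\<And>j. j < m \<Longrightarrow> \<sigma> $ j \<noteq> 0 \<Longrightarrow> \<alpha> $ j \<noteq> 0 \<and> \<sigma> $ j = sgn (\<alpha> $ j)"
      using exists_conformal_unit_elementary[OF _ assms(2,4,5,7) ker\<alpha> assms(9)] by blast
    have unit: "\<sigma> $ j \<in> {-1, 0, 1}" if "j < m" for j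
      using \<sigma>(2)[OF that] sgn_if[of "\<alpha> $ j"] by (cases "\<sigma> $ j = 0") auto
    have \<sigma>ker: "\<sigma> \<in> mat_kernel (real_mat M)" "\<sigma> \<noteq> 0\<^sub>v m"
      using \<sigma>(1) by (auto simp: elementary_def dimM)
    have "\<sigma> $ j \<in> \<int>" if "j < m" for j using unit[OF that] by auto
    then have \<sigma>flow: "\<sigma> \<in> flow_lattice M" using \<sigma>ker(1) by (simp add: flow)
    note dims = dim[OF assms(8)] dim[OF \<sigma>flow]
    define \<gamma> where "\<gamma> = \<alpha> - 1 \<cdot>\<^sub>v \<sigma>"
    have \<gamma>j: "\<gamma> $ j = \<alpha> $ j - \<sigma> $ j" if "j < m" for j using that by (simp add: \<gamma>_def dims)
    have "\<gamma> \<in> mat_kernel (real_mat M)"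
      unfolding \<gamma>_def using ker\<alpha> \<sigma>ker(1) by (rule mat_kernel_minus_smult)
    then have \<gamma>flow: "\<gamma> \<in> flow_lattice M"
      using assms(8) \<sigma>flow by (auto simp: flow \<gamma>j)
    have "\<alpha> = \<sigma> + \<gamma>" using dims dim[OF \<gamma>flow] by (auto simp: vec_eq_iff \<gamma>j)
    moreover have "0 \<le> \<sigma> $ j * \<gamma> $ j" if j: "j < m" for j
    proof (cases "\<sigma> $ j = 0")
      case False
      have "\<alpha> $ j \<in> \<int>" using assms(8) j by (auto simp: flow)
      then obtain a :: int where a: "\<alpha> $ j = of_int a" by (elim Ints_cases)
      have "a \<noteq> 0" "\<sigma> $ j = of_int (sgn a)" using \<sigma>(2)[OF j False] a by (auto simp: sgn_if)
      then show ?thesis by (cases "a > 0") (auto simp: \<gamma>j[OF j] a)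
    qed simp
    then have "0 \<le> \<sigma> \<bullet> \<gamma>"
      using dim[OF \<gamma>flow] by (auto simp: scalar_prod_def intro!: sum_nonneg)
    ultimately have "\<gamma> = 0\<^sub>v m" using neg \<sigma>flow \<gamma>flow \<sigma>ker(2) by force
    then have "\<alpha> = \<sigma>" using dims \<gamma>j by (auto simp: vec_eq_iff)
    then show "elementary (real_mat M) \<alpha> \<and> (\<forall>j<m. \<alpha> $ j \<in> {-1, 0, 1})"
      using \<sigma>(1) unit by simp
  qed
qed

end
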